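(* Let $D\subset\mathbb C^3$ be a bounded quasi-circular domain containing the origin, with weight $(m_1,m_2,m_3)$, where $m_1<m_2<m_3$, satisfying: (i) $3\le m_1$; (ii) $m_2\not\equiv0\pmod{m_1}$ and $m_3\not\equiv 0\pmod{m_1}$; (iii) $m_1+m_2>m_3$. Then every holomorphic automorphism $f$ of $D$ with $f(0)=0$ is linear, i.e. is the restriction to $D$ of a $\mathbb C$-linear map $\mathbb C^3\to\mathbb C^3$.
   Context: A weight is a triple of positive integers $(m_1,m_2,m_3)$ with $\gcd(m_1,m_2,m_3)=1$. A domain (connected open set) $D\subset\mathbb C^3$ is quasi-circular with weight $(m_1,m_2,m_3)$ if for every $\theta\in\mathbb R$ it is invariant under the map $(z_1,z_2,z_3)\mapsto(e^{im_1\theta}z_1,e^{im_2\theta}z_2,e^{im_3\theta}z_3)$. A holomorphic automorphism of $D$ is a biholomorphic map $D\to D$. *)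

theory Defs
  imports "HOL-Analysis.Analysis" "HOL-Number_Theory.Cong"
begin

text \<open>Holomorphy in several variables: the real Frechet derivative exists and is complex linear.
  The scalar multiplication in \<open>Vector_Spaces.linear\<close> is the complex one \<open>(*s)\<close>; plain
  \<open>linear\<close> would only mean real linear. The notion is intended for open \<open>S\<close>.\<close>

definition holomorphic_map_on :: "(complex ^ 'n \<Rightarrow> complex ^ 'm) \<Rightarrow> (complex ^ 'n) set \<Rightarrow> bool"
  where "holomorphic_map_on f S \<longleftrightarrow>
    (\<forall>z\<in>S. \<exists>f'. Vector_Spaces.linear (*s) (*s) f' \<and> (f has_derivative f') (at z within S))"

definition biholomorphic_map ::
  "(complex ^ 'n \<Rightarrow> complex ^ 'm) \<Rightarrow> (complex ^ 'n) set \<Rightarrow> (complex ^ 'm) set \<Rightarrow> bool"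
  where "biholomorphic_map f S T \<longleftrightarrow>
    bij_betw f S T \<and> holomorphic_map_on f S \<and> holomorphic_map_on (inv_into S f) T"

definition holomorphic_automorphism :: "(complex ^ 'n \<Rightarrow> complex ^ 'n) \<Rightarrow> (complex ^ 'n) set \<Rightarrow> bool"
  where "holomorphic_automorphism f D \<longleftrightarrow> biholomorphic_map f D D"

definition is_domain :: "(complex ^ 'n) set \<Rightarrow> bool"
  where "is_domain D \<longleftrightarrow> open D \<and> connected D"

definition is_weight :: "nat \<Rightarrow> nat \<Rightarrow> nat \<Rightarrow> bool"
  where "is_weight m1 m2 m3 \<longleftrightarrow>
    0 < m1 \<and> 0 < m2 \<and> 0 < m3 \<and> gcd (gcd m1 m2) m3 = 1"

definition weighted_rotation :: "nat \<Rightarrow> nat \<Rightarrow> nat \<Rightarrow> real \<Rightarrow> complex ^ 3 \<Rightarrow> complex ^ 3"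
  where "weighted_rotation m1 m2 m3 \<theta> z =
    vector [exp (\<i> * of_nat m1 * of_real \<theta>) * z $ 1,
            exp (\<i> * of_nat m2 * of_real \<theta>) * z $ 2,
            exp (\<i> * of_nat m3 * of_real \<theta>) * z $ 3]"

definition quasi_circular_domain :: "nat \<Rightarrow> nat \<Rightarrow> nat \<Rightarrow> (complex ^ 3) set \<Rightarrow> bool"
  where "quasi_circular_domain m1 m2 m3 D \<longleftrightarrow>
    is_domain D \<and> is_weight m1 m2 m3 \<and>
    (\<forall>\<theta>::real. weighted_rotation m1 m2 m3 \<theta> ` D = D)"

end

theory Submission
  imports Defs "HOL-Complex_Analysis.Conformal_Mappings"
begin

text \<open>
  For an automorphism \<open>k\<close> fixing the origin let \<open>\<delta>\<^sub>k = k'(0)\<inverse> \<circ> k - id\<close> be its deviation from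
  its linear part. Write \<open>l = k\<inverse>\<close>, fix \<open>z\<close> near 0 and let \<open>\<rho>\<^sub>j\<close> be the rotation by \<open>2\<pi>j/N\<close>. The
  automorphism \<open>l \<circ> \<rho>\<^sub>j \<circ> k\<close> has deviation \<open>d + X\<^sub>j\<close> at \<open>z\<close>, where \<open>d = \<delta>\<^sub>k(z)\<close>, \<open>X\<^sub>0 = -d\<close>, and \<open>X\<^sub>j\<close> is
  a linear image of \<open>\<rho>\<^sub>j\<inverse> \<circ> \<delta>\<^sub>l \<circ> \<rho>\<^sub>j\<close> evaluated at \<open>k(z)\<close>. The weights admit no resonances, so averaging the
  latter over \<open>j\<close> kills all Taylor coefficients below order \<open>N\<close>, and the mean of the \<open>X\<^sub>j\<close> is \<open>O(2\<^sup>-\<^sup>N)\<close>.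
  Let \<open>S\<close> be the supremum of \<open>norm d\<close> squared over all automorphisms. Summing the squared norms
  of \<open>d + X\<^sub>j\<close>, in which \<open>X\<^sub>0\<close> alone contributes an extra \<open>norm d\<close> squared, gives
  \<open>N S \<ge> (N + 1) S - o(1)\<close>, hence \<open>S = 0\<close>: near 0 every automorphism is linear. This replaces the
  Haar measure on the isotropy group and the Bergman kernel.
\<close>

section \<open>Taylor coefficients and Schwarz estimates in one variable\<close>

text \<open>Cauchy's inequality on the circle of radius \<open>\<rho>\<close> bounds the derivative
  by a multiple of \<open>\<rho> ^ (k - n)\<close>, and \<open>\<rho>\<close> may shrink to
  0.\<close>

lemma higher_deriv_eq_0_if_small:
  fixes f :: "complex \<Rightarrow> complex"
  assumes hol: "f holomorphic_on ball 0 r" and r: "r > 0"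
    and le: "\<And>z. norm z < r \<Longrightarrow> norm (f z) \<le> K * norm z ^ k" and "n < k"
  shows "(deriv ^^ n) f 0 = 0"
proof -
  have bound: "norm ((deriv ^^ n) f 0) \<le> fact n * K * \<rho> ^ (k - n)" if \<rho>: "0 < \<rho>" "\<rho> < r" for \<rho>
  proof -
    have "norm ((deriv ^^ n) f 0) \<le> fact n * (K * \<rho> ^ k) / \<rho> ^ n"
    proof (rule Cauchy_inequality)
      show "f holomorphic_on ball 0 \<rho>"
        using \<rho> by (intro holomorphic_on_subset[OF hol]) auto
      show "continuous_on (cball 0 \<rho>) f"
        using \<rho> by (intro holomorphic_on_imp_continuous_on holomorphic_on_subset[OF hol]) auto
      show "norm (f x) \<le> K * \<rho> ^ k" if "norm (0 - x) = \<rho>" for x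
        using le[of x] that \<rho> by simp
    qed (use \<rho> in auto)
    also have "\<dots> = fact n * K * \<rho> ^ (k - n)"
      using \<open>n < k\<close> \<rho> by (simp add: power_diff)
    finally show ?thesis .
  qed
  have "((\<lambda>\<rho>. fact n * K * \<rho> ^ (k - n)) \<longlongrightarrow> fact n * K * 0 ^ (k - n)) (at_right 0)"
    by (intro tendsto_intros)
  moreover have "\<forall>\<^sub>F \<rho> in at_right 0. norm ((deriv ^^ n) f 0) \<le> fact n * K * \<rho> ^ (k - n)"
    unfolding eventually_at_right_field using r bound by blast
  ultimately have "norm ((deriv ^^ n) f 0) \<le> fact n * K * 0 ^ (k - n)"
    by (rule tendsto_lowerbound) simp
  then show ?thesis using \<open>n < k\<close> by (simp add: power_0_left)
qed

text \<open>The Schwarz lemma on the unit disc wants a strict bound by 1. Rescaling by some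
  \<open>M'\<close> strictly above \<open>M\<close> provides it, and \<open>M'\<close> then
  decreases to \<open>M\<close>; this also covers \<open>M = 0\<close>.\<close>

lemma Schwarz_bound:
  fixes f :: "complex \<Rightarrow> complex"
  assumes hol: "f holomorphic_on ball 0 r" and r: "r > 0" and f0: "f 0 = 0"
    and le: "\<And>z. norm z < r \<Longrightarrow> norm (f z) \<le> M" and z: "norm z < r"
  shows "norm (f z) \<le> M * norm z / r"
proof -
  have strict: "norm (f z) \<le> M' * norm z / r" if M': "M' > M" for M'
  proof -
    have M'0: "M' > 0" using le[of 0] f0 r M' by simp
    define g where "g = (\<lambda>w. f (of_real r * w) / of_real M')"
    have img: "(\<lambda>w. of_real r * w) ` ball 0 1 \<subseteq> ball (0::complex) r"
      using r by (auto simp: norm_mult)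
    have "(f \<circ> (\<lambda>w. of_real r * w)) holomorphic_on ball 0 1"
      by (rule holomorphic_on_compose_gen[OF _ hol img]) (intro holomorphic_intros)
    then have "g holomorphic_on ball 0 1"
      unfolding g_def comp_def by (intro holomorphic_intros) (use M'0 in auto)
    moreover have "g 0 = 0" by (simp add: g_def f0)
    moreover have "norm (g w) < 1" if "norm w < 1" for w
      using le[of "of_real r * w"] that r M' M'0 by (simp add: g_def norm_mult norm_divide)
    moreover have "norm (z / of_real r) < 1" using z r by (simp add: norm_divide)
    ultimately have "norm (g (z / of_real r)) \<le> norm (z / of_real r)"
      using Schwarz_Lemma(1) by blast
    then show ?thesis using r M'0 by (simp add: g_def norm_divide field_simps)
  qed
  have "((\<lambda>M'. M' * norm z / r) \<longlongrightarrow> M * norm z / r) (at_right M)"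
    by (intro tendsto_intros) (use r in auto)
  moreover have "\<forall>\<^sub>F M' in at_right M. norm (f z) \<le> M' * norm z / r"
    using strict by (simp add: eventually_at_right_less eventually_at_filter)
  ultimately show ?thesis
    by (rule tendsto_lowerbound) simp
qed

text \<open>The quotient \<open>f w / w\<close> extends holomorphically with value
  \<open>deriv f 0 = 0\<close> at the origin and is bounded by \<open>M / r\<close>, so the
  first-order bound applies a second time.\<close>

lemma Schwarz_bound2:
  fixes f :: "complex \<Rightarrow> complex"
  assumes hol: "f holomorphic_on ball 0 r" and r: "r > 0" and f0: "f 0 = 0" and f'0: "deriv f 0 = 0"
    and le: "\<And>z. norm z < r \<Longrightarrow> norm (f z) \<le> M" and z: "norm z < r"
  shows "norm (f z) \<le> M * (norm z / r)\<^sup>2"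
proof -
  define g where "g = (\<lambda>w. if w = 0 then deriv f 0 else f w / w)"
  have "g holomorphic_on ball 0 r"
    using pole_theorem_open_0[of f "ball 0 r" 0 g] hol r f0
    by (auto simp: g_def)
  moreover have "g 0 = 0" by (simp add: g_def f'0)
  moreover have "norm (g w) \<le> M / r" if "norm w < r" for w
  proof (cases "w = 0")
    case True
    then show ?thesis using le[of 0] f0 r f'0 by (simp add: g_def)
  next
    case False
    then show ?thesis using Schwarz_bound[OF hol r f0 le that] by (simp add: g_def norm_divide field_simps)
  qed
  ultimately have "norm (g z) \<le> M / r * norm z / r"
    using Schwarz_bound r z by blast
  then show ?thesis
    by (cases "z = 0") (use f0 r in \<open>auto simp: g_def norm_divide power2_eq_square field_simps\<close>)
qed

section \<open>Averages over roots of unity\<close>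

text \<open>A geometric sum over an \<open>N\<close>-th root of unity \<open>x\<close>; here
  \<open>x\<close> differs from 1 because \<open>n - m\<close> is nonzero and smaller than
  \<open>N\<close> in absolute value.\<close>

lemma sum_cis_multiples:
  assumes "n < N" "m < N" "n \<noteq> m"
  shows "(\<Sum>j<N. cis (2 * pi * real j / N * (real n - real m))) = 0"
proof -
  define x where "x = cis (2 * pi * (real n - real m) / N)"
  have N: "N > 0" using assms by simp
  have "x ^ N = cis (2 * pi * (real n - real m))"
    unfolding x_def Complex.DeMoivre by (rule arg_cong[of _ _ cis]) (use N in \<open>simp add: field_simps\<close>)
  also have "\<dots> = cis (2 * pi * real_of_int (int n - int m))" by simp
  also have "\<dots> = 1" by (simp only: cis_multiple_2pi Ints_of_int)
  finally have xN: "x ^ N = 1" .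
  have "x \<noteq> 1"
  proof
    assume "x = 1"
    then have "cos (2 * pi * (real n - real m) / N) = 1"
      by (metis x_def cis.sel(1) one_complex.sel(1))
    then obtain k :: int where k: "2 * pi * (real n - real m) / N = real_of_int k * 2 * pi"
      using cos_one_2pi_int by blast
    then have "2 * pi * (real n - real m) = 2 * pi * (real_of_int k * real N)"
      using N by (simp add: divide_eq_eq mult_ac)
    then have "real n - real m = real_of_int k * real N" by simp
    then have "of_int (int n - int m) = (of_int (k * int N) :: real)" by simp
    then have *: "int n - int m = k * int N" by (simp only: of_int_eq_iff)
    then have "int N dvd (int n - int m)" by simp
    then have "\<bar>int N\<bar> \<le> \<bar>int n - int m\<bar>" using assms(3) by (intro dvd_imp_le_int) auto
    then show False using assms by simp
  qed
  have "(\<Sum>j<N. cis (2 * pi * real j / N * (real n - real m))) = (\<Sum>j<N. x ^ j)"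
    unfolding x_def Complex.DeMoivre
    by (intro sum.cong refl arg_cong[of _ _ cis]) (simp add: field_simps)
  also have "\<dots> = 0" using \<open>x \<noteq> 1\<close> xN by (simp add: geometric_sum)
  finally show ?thesis .
qed

text \<open>In the power series of \<open>h\<close> the sum over \<open>j\<close> annihilates every
  term of index below \<open>N\<close> other than the \<open>m\<close>-th, which vanishes by
  hypothesis. What remains is a tail starting at index \<open>N\<close>, evaluated on the unit
  circle.\<close>

lemma root_of_unity_average_bound:
  fixes h :: "complex \<Rightarrow> complex"
  assumes hol: "h holomorphic_on ball 0 3" and le: "\<And>z. norm z < 3 \<Longrightarrow> norm (h z) \<le> M"
    and h0: "(deriv ^^ m) h 0 = 0" and "m < N"
  shows "norm (\<Sum>j<N. cis (- (2 * pi * real j / N) * m) * h (cis (2 * pi * real j / N)))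
           \<le> 2 * M * real N / 2 ^ N"
proof -
  define a where "a n = (deriv ^^ n) h 0 / fact n" for n
  define z where "z j = cis (2 * pi * real j / N)" for j
  define s where "s n = (\<Sum>j<N. cis (2 * pi * real j / N * (real n - real m)))" for n
  have M: "M \<ge> 0" using le[of 0] by (smt (verit) norm_ge_zero norm_zero)
  \<comment> \<open>Any radius strictly between 1 and 3 would give geometric decay on the unit
    circle; 2 makes the tail of order \<open>2 ^ (- N)\<close> up to the factor
    \<open>N\<close>.\<close>
  have a_le: "norm (a n) \<le> M / 2 ^ n" for n
  proof -
    have "norm ((deriv ^^ n) h 0) \<le> fact n * M / 2 ^ n"
    proof (rule Cauchy_inequality)
      show "h holomorphic_on ball 0 2"
        using hol by (rule holomorphic_on_subset) auto
      show "continuous_on (cball 0 2) h"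
        using hol by (auto intro!: holomorphic_on_imp_continuous_on intro: holomorphic_on_subset)
    qed (use le in auto)
    then show ?thesis by (simp add: a_def norm_divide field_simps)
  qed
  have "(\<lambda>n. a n * z j ^ n) sums h (z j)" for j
    using holomorphic_power_series[OF hol, of "z j"] by (simp add: a_def z_def)
  then have "(\<lambda>n. \<Sum>j<N. cis (- (2 * pi * real j / N) * m) * (a n * z j ^ n)) sums
      (\<Sum>j<N. cis (- (2 * pi * real j / N) * m) * h (z j))"
    by (intro sums_sum sums_mult)
  moreover have "(\<Sum>j<N. cis (- (2 * pi * real j / N) * m) * (a n * z j ^ n)) = a n * s n" for n
  proof -
    have "cis (- (2 * pi * real j / N) * m) * z j ^ n = cis (2 * pi * real j / N * (real n - real m))" for j
      unfolding z_def Complex.DeMoivre cis_mult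
      by (rule arg_cong[of _ _ cis]) (simp add: algebra_simps flip: diff_divide_distrib)
    then have "cis (- (2 * pi * real j / N) * m) * (a n * z j ^ n)
        = a n * cis (2 * pi * real j / N * (real n - real m))" for j
      by (simp only: flip: mult.assoc) (simp only: ac_simps)
    then show ?thesis by (simp only: s_def sum_distrib_left)
  qed
  ultimately have sums: "(\<lambda>n. a n * s n) sums (\<Sum>j<N. cis (- (2 * pi * real j / N) * m) * h (z j))"
    by simp
  have zero: "a n * s n = 0" if "n < N" for n
    using sum_cis_multiples[of n N m] that \<open>m < N\<close> h0 by (cases "n = m") (auto simp: s_def a_def)
  have "norm (s n) \<le> N" for n
    unfolding s_def by (rule order_trans[OF norm_sum]) simp
  then have term_le: "norm (a (n + N) * s (n + N)) \<le> (M * N / 2 ^ N) * (1/2) ^ n" for n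
    using mult_mono[OF a_le[of "n + N"], of "norm (s (n + N))" "real N"] M
    by (simp add: norm_mult power_add power_divide mult.commute[of "2 ^ n"])
  have tail: "(\<lambda>n. a (n + N) * s (n + N)) sums (\<Sum>j<N. cis (- (2 * pi * real j / N) * m) * h (z j))"
    using sums sums_iff_shift[of "\<lambda>n. a n * s n" N] zero by simp
  have geo: "(\<lambda>n. (M * N / 2 ^ N) * (1/2) ^ n) sums ((M * N / 2 ^ N) * (1 / (1 - 1/2)))"
    by (intro sums_mult geometric_sums) simp
  have "norm (\<Sum>n. a (n + N) * s (n + N)) \<le> (\<Sum>n. (M * N / 2 ^ N) * (1/2) ^ n)"
    by (rule norm_suminf_le[OF term_le]) (use geo sums_summable in blast)
  also have "\<dots> = 2 * M * real N / 2 ^ N" unfolding sums_unique[OF geo, symmetric] by simp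
  finally show ?thesis using sums_unique[OF tail] by (simp add: z_def)
qed

section \<open>The averaging argument in an inner product space\<close>

text \<open>The abstract core of the proof. One sequence \<open>\<epsilon>\<close> has to serve all
  of \<open>A\<close>, since the supremum over \<open>d\<close> is taken at fixed \<open>N\<close>,
  before \<open>N\<close> tends to infinity. The threshold \<open>N0\<close> leaves room for
  averages that are small only once \<open>N\<close> exceeds the weights.\<close>

lemma subset_zero_if_averaging:
  fixes A :: "'a::real_inner set"
  assumes bdd: "bounded A" and \<epsilon>: "\<epsilon> \<longlonglongrightarrow> 0"
    and avg: "\<And>N d. N0 \<le> N \<Longrightarrow> d \<in> A \<Longrightarrow>
      \<exists>X. (\<forall>j<N. d + X j \<in> A) \<and> X 0 = - d \<and> norm (\<Sum>j<N. X j) \<le> \<epsilon> N"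
  shows "A \<subseteq> {0}"
proof (cases "A = {}")
  case False
  define s where "s = (SUP d\<in>A. (norm d)\<^sup>2)"
  obtain B where B: "\<And>d. d \<in> A \<Longrightarrow> norm d \<le> B" using bdd bounded_iff by blast
  have B0: "B \<ge> 0" using False B by (meson all_not_in_conv norm_ge_zero order_trans)
  have bdd': "bdd_above ((\<lambda>d. (norm d)\<^sup>2) ` A)"
    using B by (intro bdd_aboveI[of _ "B\<^sup>2"]) (auto intro: power_mono)
  have le_s: "(norm d)\<^sup>2 \<le> s" if "d \<in> A" for d
    unfolding s_def by (rule cSUP_upper[OF that bdd'])
  have key: "s \<le> 2 * B * \<epsilon> N" if N: "N \<ge> max N0 1" for N
  proof -
    have "(norm d)\<^sup>2 \<le> (real N * s + 2 * B * \<epsilon> N) / (real N + 1)" if d: "d \<in> A" for d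
    proof -
      obtain X where X: "\<And>j. j < N \<Longrightarrow> d + X j \<in> A" "X 0 = - d" "norm (\<Sum>j<N. X j) \<le> \<epsilon> N"
        using avg[OF _ d] N by auto
      have "(\<Sum>j<N. (norm (d + X j))\<^sup>2) \<le> real N * s"
        using sum_bounded_above[of "{..<N}" "\<lambda>j. (norm (d + X j))\<^sup>2" s] le_s X(1) by simp
      moreover have "(\<Sum>j<N. (norm (d + X j))\<^sup>2)
          = real N * (norm d)\<^sup>2 + 2 * (d \<bullet> (\<Sum>j<N. X j)) + (\<Sum>j<N. (norm (X j))\<^sup>2)"
        by (simp add: power2_norm_eq_inner inner_add inner_commute sum.distrib inner_sum_right
            algebra_simps sum_distrib_left)
      \<comment> \<open>Since \<open>N\<close> is at least 1, the index 0 occurs in the sum, and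
        \<open>X 0 = - d\<close> alone supplies the gain.\<close>
      moreover have "(norm d)\<^sup>2 \<le> (\<Sum>j<N. (norm (X j))\<^sup>2)"
        using member_le_sum[of 0 "{..<N}" "\<lambda>j. (norm (X j))\<^sup>2"] N X(2) by simp
      moreover have "\<bar>d \<bullet> (\<Sum>j<N. X j)\<bar> \<le> B * \<epsilon> N"
        by (rule order_trans[OF Cauchy_Schwarz_ineq2]) (intro mult_mono B[OF d] X(3) B0 norm_ge_zero)
      ultimately have "(real N + 1) * (norm d)\<^sup>2 \<le> real N * s + 2 * B * \<epsilon> N"
        by (auto simp: algebra_simps)
      then show ?thesis by (simp add: field_simps)
    qed
    then have "s \<le> (real N * s + 2 * B * \<epsilon> N) / (real N + 1)"
      unfolding s_def using False by (intro cSUP_least) auto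
    then show ?thesis by (simp add: field_simps)
  qed
  have "(\<lambda>N. 2 * B * \<epsilon> N) \<longlonglongrightarrow> 2 * B * 0" by (intro tendsto_intros \<epsilon>)
  then have "s \<le> 2 * B * 0"
    by (rule LIMSEQ_le_const) (use key in blast)
  then have "(norm d)\<^sup>2 \<le> 0" if "d \<in> A" for d using le_s[OF that] by linarith
  then show ?thesis by auto
qed simp

section \<open>Holomorphic maps in several variables\<close>

lemma norm_vector_scalar_mult: "norm (c *s v) = norm c * norm (v :: complex ^ 'n)"
  by (simp add: norm_vec_def norm_mult L2_set_right_distrib)

lemma scaleR_eq_vector_scalar_mult: "r *\<^sub>R x = (of_real r :: complex) *s (x :: complex ^ 'n)"
  unfolding vec_eq_iff vector_scaleR_component vector_smult_component
  by (simp add: scaleR_conv_of_real)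

lemma bounded_linear_vector_scalar_mult_left: "bounded_linear (\<lambda>h. h *s (v :: complex ^ 'n))"
  by (rule bounded_linear_intro[where K = "norm v"])
    (auto simp: norm_vector_scalar_mult vec_eq_iff algebra_simps)

lemma complex_linear_imp_bounded_linear:
  fixes f :: "complex ^ 'n \<Rightarrow> complex ^ 'm"
  assumes "Vector_Spaces.linear (*s) (*s) f"
  shows "bounded_linear f"
proof -
  have "linear f"
    using module_hom.add[OF assms[unfolded linear_iff_module_hom]]
      module_hom.scale[OF assms[unfolded linear_iff_module_hom]]
    by (intro linearI) (simp_all add: scaleR_eq_vector_scalar_mult)
  then show ?thesis by (simp add: linear_conv_bounded_linear)
qed

lemma has_derivative_curve:
  fixes \<gamma> :: "complex \<Rightarrow> complex ^ 'n"
  assumes "\<And>i. ((\<lambda>t. \<gamma> t $ i) has_field_derivative v $ i) (at t)"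
  shows "(\<gamma> has_derivative (\<lambda>h. h *s v)) (at t)"
  unfolding has_derivative_at_within
proof (intro conjI vec_tendstoI)
  show "bounded_linear (\<lambda>h. h *s v)"
    by (rule bounded_linear_vector_scalar_mult_left)
  show "((\<lambda>y. ((\<gamma> y - \<gamma> t - (y - t) *s v) /\<^sub>R norm (y - t)) $ i) \<longlongrightarrow> 0 $ i) (at t)" for i
    using assms[of i] by (simp add: has_field_derivative_def has_derivative_at_within algebra_simps)
qed

text \<open>The bridge to one-variable theory: by the chain rule and complex linearity of
  \<open>f'\<close>, the derivative along a holomorphic curve with tangent \<open>v\<close> is
  multiplication by the number \<open>f' v $ i\<close>.\<close>

lemma holomorphic_on_component_compose:
  fixes f :: "complex ^ 'n \<Rightarrow> complex ^ 'm"
  assumes f: "holomorphic_map_on f S" and "open S" "open U"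
    and \<gamma>: "\<And>i. (\<lambda>t. (\<gamma> t :: complex ^ 'n) $ i) holomorphic_on U" and sub: "\<gamma> ` U \<subseteq> S"
  shows "(\<lambda>t. f (\<gamma> t) $ i) holomorphic_on U"
proof (subst holomorphic_on_open[OF \<open>open U\<close>], intro ballI)
  fix t assume t: "t \<in> U"
  define v where "v = (\<chi> i. deriv (\<lambda>t. \<gamma> t $ i) t)"
  have 1: "(\<gamma> has_derivative (\<lambda>h. h *s v)) (at t)"
    by (rule has_derivative_curve)
      (use holomorphic_derivI[OF \<gamma> \<open>open U\<close> t] in \<open>simp add: v_def\<close>)
  obtain f' where f': "Vector_Spaces.linear (*s) (*s) f'" "(f has_derivative f') (at (\<gamma> t))"
    using f sub t \<open>open S\<close> unfolding holomorphic_map_on_def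
    by (metis at_within_open image_subset_iff)
  have "((\<lambda>t. f (\<gamma> t)) has_derivative (\<lambda>h. f' (h *s v))) (at t)"
    using has_derivative_compose[OF 1 f'(2)] .
  then have "((\<lambda>t. f (\<gamma> t) $ i) has_derivative (\<lambda>h. f' (h *s v) $ i)) (at t)"
    by (rule bounded_linear.has_derivative[OF bounded_linear_vec_nth])
  moreover have "(\<lambda>h. f' (h *s v) $ i) = (*) (f' v $ i)"
    using module_hom.scale[OF f'(1)[unfolded linear_iff_module_hom]] by (auto simp: fun_eq_iff mult.commute)
  ultimately show "\<exists>f'. ((\<lambda>t. f (\<gamma> t) $ i) has_field_derivative f') (at t)"
    unfolding has_field_derivative_def by metis
qed

lemma holomorphic_map_on_compose:
  assumes f: "holomorphic_map_on f S" and g: "holomorphic_map_on g T" and sub: "f ` S \<subseteq> T"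
  shows "holomorphic_map_on (\<lambda>z. g (f z)) S"
  unfolding holomorphic_map_on_def
proof
  fix z assume z: "z \<in> S"
  obtain f' where f': "Vector_Spaces.linear (*s) (*s) f'" "(f has_derivative f') (at z within S)"
    using f z unfolding holomorphic_map_on_def by blast
  obtain g' where g': "Vector_Spaces.linear (*s) (*s) g'" "(g has_derivative g') (at (f z) within T)"
    using g z sub unfolding holomorphic_map_on_def by blast
  have "((\<lambda>z. g (f z)) has_derivative (\<lambda>h. g' (f' h))) (at z within S)"
    using has_derivative_in_compose[OF f'(2)] has_derivative_subset[OF g'(2) sub] by blast
  moreover have "Vector_Spaces.linear (*s) (*s) (\<lambda>h. g' (f' h))"
    using Vector_Spaces.linear_compose[OF f'(1) g'(1)] by (simp add: o_def)
  ultimately show "\<exists>f'. Vector_Spaces.linear (*s) (*s) f' \<and>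
      ((\<lambda>z. g (f z)) has_derivative f') (at z within S)" by blast
qed

lemma holomorphic_map_on_diff:
  assumes f: "holomorphic_map_on f S" and g: "holomorphic_map_on g S"
  shows "holomorphic_map_on (\<lambda>z. f z - g z) S"
  unfolding holomorphic_map_on_def
proof
  fix z assume z: "z \<in> S"
  obtain f' where f': "Vector_Spaces.linear (*s) (*s) f'" "(f has_derivative f') (at z within S)"
    using f z unfolding holomorphic_map_on_def by blast
  obtain g' where g': "Vector_Spaces.linear (*s) (*s) g'" "(g has_derivative g') (at z within S)"
    using g z unfolding holomorphic_map_on_def by blast
  have "Vector_Spaces.linear (*s) (*s) (\<lambda>h. f' h - g' h)"
    using f'(1) g'(1) by (rule vec.linear_compose_sub)
  with has_derivative_diff[OF f'(2) g'(2)]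
  show "\<exists>f'. Vector_Spaces.linear (*s) (*s) f' \<and>
      ((\<lambda>z. f z - g z) has_derivative f') (at z within S)" by blast
qed

lemma complex_linear_imp_holomorphic_map_on:
  fixes f :: "complex ^ 'n \<Rightarrow> complex ^ 'm"
  assumes "Vector_Spaces.linear (*s) (*s) f"
  shows "holomorphic_map_on f S"
  unfolding holomorphic_map_on_def
  using assms complex_linear_imp_bounded_linear bounded_linear_imp_has_derivative by blast

lemma holomorphic_map_on_subset:
  assumes "holomorphic_map_on f S" "T \<subseteq> S"
  shows "holomorphic_map_on f T"
  using assms unfolding holomorphic_map_on_def by (meson has_derivative_subset subsetD)

lemma holomorphic_map_on_frechet_derivative:
  fixes f :: "complex ^ 'n \<Rightarrow> complex ^ 'm"
  assumes "holomorphic_map_on f S" "open S" "z \<in> S"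
  shows "(f has_derivative frechet_derivative f (at z)) (at z)"
    and "Vector_Spaces.linear (*s) (*s) (frechet_derivative f (at z))"
proof -
  obtain f' where f': "Vector_Spaces.linear (*s) (*s) f'" "(f has_derivative f') (at z)"
    using assms unfolding holomorphic_map_on_def by (metis at_within_open)
  have "frechet_derivative f (at z) = f'" using frechet_derivative_at[OF f'(2)] by simp
  with f' show "(f has_derivative frechet_derivative f (at z)) (at z)"
    "Vector_Spaces.linear (*s) (*s) (frechet_derivative f (at z))" by simp_all
qed

text \<open>The one-variable Schwarz lemma is applied to each component on the complex line through
  \<open>z\<close>. The dimension factor comes from bounding the norm by the sum over the
  components.\<close>

lemma holomorphic_map_Schwarz_bound:
  fixes f :: "complex ^ 'n \<Rightarrow> complex ^ 'm"
  assumes f: "holomorphic_map_on f (ball 0 r)" and f0: "f 0 = 0"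
    and le: "\<And>z. norm z < r \<Longrightarrow> norm (f z) \<le> M" and z: "norm z < r"
  shows "norm (f z) \<le> real CARD('m) * M / r * norm z"
proof (cases "z = 0")
  case False
  have r: "r > 0" using z by (smt (verit) norm_ge_zero)
  have comp: "norm (f z $ i) \<le> M / r * norm z" for i
  proof -
    \<comment> \<open>The disc of radius \<open>R\<close> is the preimage of the ball under the
      parametrization of the line that sends 1 to \<open>z\<close>.\<close>
    define R where "R = r / norm z"
    have R: "R > 1" "R * norm z = r" using z False by (auto simp: R_def)
    have in_ball: "norm (t *s z) < r" if "norm t < R" for t
      using that R False by (simp add: norm_vector_scalar_mult flip: R(2))
    have hol: "(\<lambda>t. f (t *s z) $ i) holomorphic_on ball 0 R"
    proof (rule holomorphic_on_component_compose[OF f])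
      show "(\<lambda>t. (t *s z) $ i) holomorphic_on ball 0 R" for i by (simp add: holomorphic_intros)
      show "(\<lambda>t. t *s z) ` ball 0 R \<subseteq> ball 0 r" using in_ball by auto
    qed auto
    have "norm (f (1 *s z) $ i) \<le> M * norm (1::complex) / R"
    proof (rule Schwarz_bound[OF hol])
      show "norm (f (t *s z) $ i) \<le> M" if "norm t < R" for t
        using order_trans[OF Finite_Cartesian_Product.norm_nth_le le[OF in_ball[OF that]]] by simp
    qed (use R f0 in auto)
    then show ?thesis using R by (simp add: R_def)
  qed
  have "norm (f z) \<le> (\<Sum>i\<in>UNIV. norm (f z $ i))"
    unfolding norm_vec_def by (rule L2_set_le_sum) auto
  also have "\<dots> \<le> real CARD('m) * (M / r * norm z)"
    by (rule order_trans[OF sum_mono[OF comp]]) simp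
  finally show ?thesis by simp
qed (use f0 in simp)

text \<open>Along real multiples of \<open>v\<close> the quotient of
  \<open>norm (f (t *\<^sub>R v))\<close> by \<open>norm t\<close> is at most
  \<open>C * norm v\<close>, and it differs from \<open>norm (f' v)\<close> by an error tending to
  0.\<close>

lemma norm_derivative_le:
  fixes f :: "complex ^ 'n \<Rightarrow> complex ^ 'm"
  assumes f: "(f has_derivative f') (at 0)" and lin: "Vector_Spaces.linear (*s) (*s) f'"
    and f0: "f 0 = 0" and r: "r > 0"
    and le: "\<And>z. norm z < r \<Longrightarrow> norm (f z) \<le> C * norm z"
  shows "norm (f' v) \<le> C * norm v"
proof (cases "v = 0")
  case True
  then show ?thesis using module_hom.zero[OF lin[unfolded linear_iff_module_hom]] by simp
next
  case False
  have "((\<lambda>t::real. t *\<^sub>R v) has_derivative (\<lambda>t. t *\<^sub>R v)) (at 0)"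
    by (auto intro!: derivative_eq_intros)
  then have "((\<lambda>t::real. f (t *\<^sub>R v)) has_derivative (\<lambda>t. f' (t *\<^sub>R v))) (at 0)"
    by (rule has_derivative_compose) (use f in simp)
  moreover have "(\<lambda>t. f' (t *\<^sub>R v)) = (\<lambda>t. t *\<^sub>R f' v)"
    using linear_scale[OF bounded_linear.linear[OF complex_linear_imp_bounded_linear[OF lin]]] by auto
  ultimately have "((\<lambda>t::real. f (t *\<^sub>R v)) has_derivative (\<lambda>t. t *\<^sub>R f' v)) (at 0)"
    by simp
  then have "((\<lambda>t. norm (f (t *\<^sub>R v) - t *\<^sub>R f' v) / norm t) \<longlongrightarrow> 0) (at 0)"
    by (simp add: has_derivative_at f0)
  then have lim: "((\<lambda>t. norm (f (t *\<^sub>R v) - t *\<^sub>R f' v) / norm t + C * norm v) \<longlongrightarrow> 0 + C * norm v) (at 0)"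
    by (intro tendsto_intros)
  have "norm (f' v) \<le> norm (f (t *\<^sub>R v) - t *\<^sub>R f' v) / norm t + C * norm v"
    if t: "t \<noteq> 0" "dist t 0 < r / norm v" for t
  proof -
    have "\<bar>t\<bar> * norm (f' v) = norm (t *\<^sub>R f' v)" by simp
    also have "\<dots> \<le> norm (f (t *\<^sub>R v) - t *\<^sub>R f' v) + norm (f (t *\<^sub>R v))"
      using norm_triangle_sub[of "t *\<^sub>R f' v" "f (t *\<^sub>R v)"] by (simp add: norm_minus_commute)
    also have "norm (f (t *\<^sub>R v)) \<le> C * (\<bar>t\<bar> * norm v)"
      using le[of "t *\<^sub>R v"] t False by (simp add: field_simps)
    finally show ?thesis using t(1) by (simp add: field_simps)
  qed
  then have "\<forall>\<^sub>F t in at 0. norm (f' v) \<le> norm (f (t *\<^sub>R v) - t *\<^sub>R f' v) / norm t + C * norm v"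
    unfolding eventually_at using r False by (intro exI[of _ "r / norm v"]) auto
  then have "norm (f' v) \<le> 0 + C * norm v"
    by (rule tendsto_lowerbound[OF lim]) simp
  then show ?thesis by simp
qed

text \<open>The interior \<open>E\<close> of the coincidence set is open and closed in
  \<open>D\<close>. For closedness, coincidence spreads from one point of \<open>E\<close> in a ball
  to the whole ball along complex lines.\<close>

theorem holomorphic_map_identity:
  fixes f g :: "complex ^ 'n \<Rightarrow> complex ^ 'm"
  assumes f: "holomorphic_map_on f D" and g: "holomorphic_map_on g D"
    and D: "open D" "connected D" and U: "open U" "U \<noteq> {}" "U \<subseteq> D"
    and eq: "\<And>z. z \<in> U \<Longrightarrow> f z = g z" and z: "z \<in> D"
  shows "f z = g z"
proof -
  define E where "E = interior {z \<in> D. f z = g z}"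
  have E_D: "E \<subseteq> D" using interior_subset unfolding E_def by blast
  have step: "ball a e \<subseteq> E" if ae: "ball a e \<subseteq> D" and b: "b \<in> E" "b \<in> ball a e" for a b e
  proof -
    have "f p = g p" if p: "p \<in> ball a e" for p
    proof -
      \<comment> \<open>The complex line from \<open>b\<close> at parameter 0 to \<open>p\<close> at
        parameter 1. The preimage of the ball is convex, hence connected, so the one-variable
        identity theorem reaches from 0 to 1.\<close>
      define \<gamma> where "\<gamma> t = b + t *s (p - b)" for t
      have cont: "continuous_on UNIV \<gamma>"
        unfolding \<gamma>_def by (intro continuous_on_add continuous_on_const
            bounded_linear.continuous_on[OF bounded_linear_vector_scalar_mult_left] continuous_on_id)
      have "open (\<gamma> -` ball a e)" "open (\<gamma> -` E)"
        using cont by (simp_all add: open_vimage E_def)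
      moreover have conv: "convex (\<gamma> -` ball a e)"
      proof (rule convexI)
        fix s t :: complex and u v :: real
        assume st: "s \<in> \<gamma> -` ball a e" "t \<in> \<gamma> -` ball a e" and uv: "0 \<le> u" "0 \<le> v" "u + v = 1"
        have "\<gamma> (u *\<^sub>R s + v *\<^sub>R t) = u *\<^sub>R \<gamma> s + v *\<^sub>R \<gamma> t"
        proof -
          have "b = (u + v) *\<^sub>R b" using uv by simp
          then show ?thesis
            unfolding \<gamma>_def by (simp add: vec_eq_iff algebra_simps)
        qed
        then show "u *\<^sub>R s + v *\<^sub>R t \<in> \<gamma> -` ball a e"
          using convexD[OF convex_ball[of a e]] st uv by auto
      qed
      have in0: "0 \<in> \<gamma> -` E" "1 \<in> \<gamma> -` ball a e" "0 \<in> \<gamma> -` ball a e"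
        using b p by (auto simp: \<gamma>_def)
      have hol: "(\<lambda>t. h (\<gamma> t) $ i) holomorphic_on (\<gamma> -` ball a e)"
        if "holomorphic_map_on h D" for h :: "complex ^ 'n \<Rightarrow> complex ^ 'm" and i
      proof (rule holomorphic_on_component_compose[OF that D(1)])
        show "(\<lambda>t. \<gamma> t $ i) holomorphic_on \<gamma> -` ball a e" for i
          unfolding \<gamma>_def by (simp add: holomorphic_intros)
      qed (use \<open>open (\<gamma> -` ball a e)\<close> ae in auto)
      have "f (\<gamma> 1) $ i = g (\<gamma> 1) $ i" for i
      proof (rule analytic_continuation_open[of "\<gamma> -` E \<inter> \<gamma> -` ball a e" "\<gamma> -` ball a e"
            "\<lambda>t. f (\<gamma> t) $ i" "\<lambda>t. g (\<gamma> t) $ i"])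
        show "f (\<gamma> t) $ i = g (\<gamma> t) $ i" if "t \<in> \<gamma> -` E \<inter> \<gamma> -` ball a e" for t
          using that interior_subset[of "{z \<in> D. f z = g z}"] by (auto simp: E_def)
        show "connected (\<gamma> -` ball a e)" using conv by (rule convex_connected)
        show "\<gamma> -` E \<inter> \<gamma> -` ball a e \<noteq> {}" using in0 by blast
      qed (use hol f g in0 \<open>open (\<gamma> -` E)\<close> \<open>open (\<gamma> -` ball a e)\<close> in auto)
      then show "f p = g p" by (simp add: \<gamma>_def vec_eq_iff)
    qed
    then show ?thesis unfolding E_def using ae by (intro interior_maximal) auto
  qed
  have "openin (top_of_set D) E" using E_D by (simp add: E_def openin_open_eq[OF D(1)])
  moreover have "closedin (top_of_set D) E"
    unfolding closedin_limpt
  proof (intro conjI allI impI E_D)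
    fix a assume "a islimpt E \<and> a \<in> D"
    then have a: "a islimpt E" "a \<in> D" by auto
    obtain e where e: "e > 0" "ball a e \<subseteq> D" using D(1) a(2) open_contains_ball by blast
    obtain b where "b \<in> E" "dist b a < e" using a(1) e(1) islimpt_approachable by blast
    then show "a \<in> E" using step[OF e(2), of b] e(1) by (auto simp: dist_commute)
  qed
  moreover have "U \<subseteq> E" unfolding E_def using U eq by (intro interior_maximal) auto
  ultimately have "E = D" using D(2) U(2) unfolding connected_clopen by blast
  then show ?thesis using z interior_subset[of "{z \<in> D. f z = g z}"] by (auto simp: E_def)
qed

section \<open>Absence of resonances\<close>

text \<open>Schwarz in \<open>t\<close> for fixed \<open>s\<close> gives a bound proportional to
  \<open>norm t\<close>; this bound then plays the role of \<open>M\<close> in a second application,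
  in \<open>s\<close>.\<close>

lemma Schwarz_bound_bidisc:
  fixes F :: "complex \<Rightarrow> complex \<Rightarrow> complex"
  assumes hol: "\<And>t. norm t < r \<Longrightarrow> (\<lambda>s. F s t) holomorphic_on ball 0 r"
      "\<And>s. norm s < r \<Longrightarrow> (\<lambda>t. F s t) holomorphic_on ball 0 r"
    and F0: "\<And>t. norm t < r \<Longrightarrow> F 0 t = 0" "\<And>s. norm s < r \<Longrightarrow> F s 0 = 0"
    and le: "\<And>s t. norm s < r \<Longrightarrow> norm t < r \<Longrightarrow> norm (F s t) \<le> M"
    and st: "norm s < r" "norm t < r"
  shows "norm (F s t) \<le> M * norm s * norm t / r\<^sup>2"
proof -
  have r: "r > 0" using st by (smt (verit) norm_ge_zero)
  have 1: "norm (F s t) \<le> M * norm t / r" if "norm s < r" for s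
    by (rule Schwarz_bound[where f = "\<lambda>t. F s t"]) (use hol F0 le that st r in auto)
  have "norm (F s t) \<le> M * norm t / r * norm s / r"
    by (rule Schwarz_bound[where f = "\<lambda>s. F s t"]) (use hol F0 1 st r in auto)
  then show ?thesis by (simp add: power2_eq_square mult_ac)
qed

text \<open>Substituting \<open>u * \<zeta>\<close> multiplies the \<open>n\<close>-th Taylor
  coefficient by \<open>u ^ n\<close>, which is not 1 for a primitive \<open>m\<close>-th root of
  unity \<open>u\<close>.\<close>

lemma higher_deriv_eq_0_if_root_invariant:
  fixes h :: "complex \<Rightarrow> complex" and m n :: nat
  assumes hol: "h holomorphic_on ball 0 r" and r: "r > 0" and m: "m > 0"
    and inv: "\<And>\<zeta>. h (cis (2 * pi / m) * \<zeta>) = h \<zeta>" and ndvd: "\<not> m dvd n"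
  shows "(deriv ^^ n) h 0 = 0"
proof -
  define u where "u = cis (2 * pi / m)"
  have "(deriv ^^ n) h 0 = (deriv ^^ n) (\<lambda>\<zeta>. h (u * \<zeta>)) 0"
    using inv by (simp add: u_def)
  also have "\<dots> = u ^ n * (deriv ^^ n) h (u * 0)"
    by (rule higher_deriv_compose_linear[OF hol, of "ball 0 r"]) (use r in \<open>auto simp: u_def norm_mult\<close>)
  finally have eq: "(deriv ^^ n) h 0 = u ^ n * (deriv ^^ n) h 0" by simp
  have "u ^ n \<noteq> 1"
  proof
    assume "u ^ n = 1"
    then have "cis (real n * (2 * pi / m)) = 1" by (simp only: u_def Complex.DeMoivre)
    then have "cos (real n * (2 * pi / m)) = 1"
      by (metis cis.sel(1) one_complex.sel(1))
    then obtain k :: int where "real n * (2 * pi / m) = real_of_int k * 2 * pi"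
      using cos_one_2pi_int by blast
    then have "2 * pi * real n = 2 * pi * (real_of_int k * real m)" using m by (simp add: field_simps)
    then have "real_of_int (int n) = real_of_int (k * int m)" by simp
    then have "int n = k * int m" by (simp only: of_int_eq_iff)
    then have "int m dvd int n" by simp
    then show False using ndvd by simp
  qed
  then show ?thesis using eq by simp
qed

text \<open>Admitting all complex \<open>\<zeta>\<close>, and not only \<open>cis \<theta>\<close>
  as for the rotations, makes the orbit of a point a holomorphic curve through the origin when the
  weights are positive.\<close>

definition weighted_action :: "('n \<Rightarrow> nat) \<Rightarrow> complex \<Rightarrow> complex ^ 'n \<Rightarrow> complex ^ 'n"
  where "weighted_action \<mu> \<zeta> z = (\<chi> i. \<zeta> ^ \<mu> i * z $ i)"

lemma weighted_action_nth [simp]: "weighted_action \<mu> \<zeta> z $ i = \<zeta> ^ \<mu> i * z $ i"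
  by (simp add: weighted_action_def)

lemma complex_linear_weighted_action: "Vector_Spaces.linear (*s) (*s) (weighted_action \<mu> \<zeta>)"
  by unfold_locales (auto simp: vec_eq_iff algebra_simps)

lemma weighted_action_mult: "weighted_action \<mu> a (weighted_action \<mu> b z) = weighted_action \<mu> (a * b) z"
  by (simp add: vec_eq_iff power_mult_distrib)

lemma weighted_action_1 [simp]: "weighted_action \<mu> 1 z = z"
  by (simp add: vec_eq_iff)

text \<open>Since \<open>g\<close> vanishes to second order, a monomial of \<open>g\<close> contributing to the coefficient of
  \<open>\<zeta> ^ \<mu> i\<close> with \<open>\<mu> i < \<mu> 1 + \<mu> 2\<close> is a power of the first variable, and the divisibility
  assumptions exclude these. The remaining monomials are estimated by the Schwarz lemma on a bidisc.\<close>

lemma nonresonant_higher_deriv_eq_0: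
  fixes g :: "complex ^ 3 \<Rightarrow> complex ^ 3" and \<mu> :: "3 \<Rightarrow> nat"
  assumes g: "holomorphic_map_on g (ball 0 r)" and g0: "g 0 = 0"
    and g'0: "(g has_derivative (\<lambda>_. 0)) (at 0)"
    and le: "\<And>z. norm z < r \<Longrightarrow> norm (g z) \<le> M"
    and \<mu>: "0 < \<mu> 1" "\<mu> 1 < \<mu> 2" "\<mu> 2 < \<mu> 3" "\<mu> 3 < \<mu> 1 + \<mu> 2" "\<not> \<mu> 1 dvd \<mu> 2" "\<not> \<mu> 1 dvd \<mu> 3"
    and R: "R > 0" and w: "\<And>\<zeta>. norm \<zeta> < R \<Longrightarrow> norm (weighted_action \<mu> \<zeta> w) < r"
  shows "(deriv ^^ \<mu> i) (\<lambda>\<zeta>. g (weighted_action \<mu> \<zeta> w) $ i) 0 = 0"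
proof -
  define c where "c z = g z $ i" for z
  \<comment> \<open>The orbit is split into its first coordinate, with direction \<open>p\<close>,
    and the other two, from which \<open>\<zeta> ^ \<mu> 2\<close> is factored out. The subtraction
    \<open>\<mu> j - \<mu> 2\<close> is exact for the indices 2 and 3.\<close>
  define p :: "complex ^ 3" where "p = (\<chi> j. if j = 1 then w $ 1 else 0)"
  define v :: "complex \<Rightarrow> complex ^ 3" where "v \<zeta> = (\<chi> j. if j = 1 then 0 else \<zeta> ^ (\<mu> j - \<mu> 2) * w $ j)" for \<zeta>
  \<comment> \<open>For \<open>s\<close> and \<open>t\<close> of norm below \<open>\<rho>\<close>
    and \<open>q\<close> no longer than \<open>w\<close>, the point \<open>s *s p + t *s q\<close>
    stays in the ball of radius \<open>r\<close>.\<close>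
  define \<rho> where "\<rho> = r / (2 * (1 + norm w))"
  define R' where "R' = min R (min 1 \<rho>)"
  define h where "h \<zeta> = c (weighted_action \<mu> \<zeta> w)" for \<zeta>
  define A where "A \<zeta> = c (\<zeta> ^ \<mu> 1 *s p)" for \<zeta>
  have r: "r > 0" using w[of 0] R by (smt (verit) norm_ge_zero norm_zero)
  have \<rho>: "\<rho> > 0" unfolding \<rho>_def using r by (simp add: add_pos_nonneg)
  have R': "R' > 0" "R' \<le> R" "R' \<le> 1" "R' \<le> \<rho>" using R \<rho> by (auto simp: R'_def)
  have c0: "c 0 = 0" by (simp add: c_def g0)
  have M: "M \<ge> 0" using le[of 0] r by (simp add: g0)
  have c_le: "norm (c z) \<le> M" if "norm z < r" for z
    unfolding c_def using order_trans[OF Finite_Cartesian_Product.norm_nth_le le[OF that]] .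
  have hol: "(\<lambda>t. c (\<gamma> t)) holomorphic_on ball 0 b"
    if "\<And>j. (\<lambda>t. \<gamma> t $ j) holomorphic_on ball 0 b" "\<And>t. norm t < b \<Longrightarrow> norm (\<gamma> t) < r" for \<gamma> b
    unfolding c_def by (rule holomorphic_on_component_compose[OF g]) (use that in auto)
  have split: "weighted_action \<mu> \<zeta> w = \<zeta> ^ \<mu> 1 *s p + \<zeta> ^ \<mu> 2 *s v \<zeta>" for \<zeta>
    using \<mu> by (auto simp: vec_eq_iff p_def v_def forall_3 simp flip: power_add)
  have p_le: "norm p \<le> norm w"
    by (rule norm_le_componentwise_cart) (auto simp: p_def)
  have v_le: "norm (v \<zeta>) \<le> norm w" if "norm \<zeta> < 1" for \<zeta>
    by (rule norm_le_componentwise_cart)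
      (use that in \<open>auto simp: v_def norm_mult norm_power intro!: mult_left_le_one_le power_le_one\<close>)
  have small: "norm (s *s p + t *s q) < r"
    if "norm s < \<rho>" "norm t < \<rho>" "norm q \<le> norm w" for s t and q :: "complex ^ 3"
  proof -
    have "norm (s *s p + t *s q) \<le> norm s * norm w + norm t * norm w"
      unfolding norm_vector_scalar_mult[symmetric]
      by (rule order_trans[OF norm_triangle_ineq add_mono])
        (use that p_le in \<open>auto simp: norm_vector_scalar_mult intro: mult_left_mono\<close>)
    also have "\<dots> \<le> 2 * \<rho> * norm w"
      using mult_right_mono[of "norm s + norm t" "2 * \<rho>" "norm w"] that by (simp add: algebra_simps)
    also have "\<dots> < 2 * \<rho> * (1 + norm w)" using \<rho> by simp
    also have "\<dots> = r"
    proof -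
      have "2 * (1 + norm w) > 0" by (simp add: add_pos_nonneg)
      then have "2 * (1 + norm w) \<noteq> 0" by (rule less_imp_neq[symmetric])
      then have "\<rho> * (2 * (1 + norm w)) = r" by (simp only: \<rho>_def times_divide_eq_left nonzero_mult_div_cancel_right not_False_eq_True)
      then show ?thesis by (simp only: mult_ac)
    qed
    finally show ?thesis .
  qed
  have small': "norm (s *s p) < r" if "norm s < \<rho>" for s
    using small[of s 0 0] that \<rho> by simp
  have small'': "norm (t *s q) < r" if "norm t < \<rho>" "norm q \<le> norm w" for t and q :: "complex ^ 3"
    using small[of 0 t q] that \<rho> by simp
  have line: "norm (c (t *s q)) \<le> M * (norm t / \<rho>)\<^sup>2" if q: "norm q \<le> norm w" and t: "norm t < \<rho>" for q t
  proof (rule Schwarz_bound2[where f = "\<lambda>t. c (t *s q)"])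
    show "(\<lambda>t. c (t *s q)) holomorphic_on ball 0 \<rho>"
      by (rule hol) (use q small'' in \<open>auto intro: holomorphic_intros\<close>)
    have "((\<lambda>t. g (t *s q)) has_derivative (\<lambda>h. 0)) (at 0)"
      using has_derivative_compose[OF bounded_linear_imp_has_derivative[OF
            bounded_linear_vector_scalar_mult_left[of q]], of g "\<lambda>_. 0" 0 UNIV] g'0 by simp
    then have "((\<lambda>t. c (t *s q)) has_derivative (\<lambda>h. 0 $ i)) (at 0)"
      unfolding c_def by (rule bounded_linear.has_derivative[OF bounded_linear_vec_nth])
    then have "((\<lambda>t. c (t *s q)) has_field_derivative 0) (at 0)"
      by (simp add: has_field_derivative_def flip: lambda_zero)
    then show "deriv (\<lambda>t. c (t *s q)) 0 = 0" by (rule DERIV_imp_deriv)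
  qed (use \<rho> c0 c_le small'' q t in auto)
  \<comment> \<open>Subtracting the values on both axes leaves the mixed part, which vanishes for
    \<open>s = 0\<close> and for \<open>t = 0\<close>. The bound is uniform in \<open>q\<close>, so
    \<open>q\<close> may later be \<open>v \<zeta>\<close>, which varies with
    \<open>\<zeta>\<close>.\<close>
  have bidisc: "norm (c (s *s p + t *s q) - c (s *s p) - c (t *s q)) \<le> 3 * M * norm s * norm t / \<rho>\<^sup>2"
    if q: "norm q \<le> norm w" and st: "norm s < \<rho>" "norm t < \<rho>" for q s t
  proof (rule Schwarz_bound_bidisc[where F = "\<lambda>s t. c (s *s p + t *s q) - c (s *s p) - c (t *s q)"])
    show "(\<lambda>s. c (s *s p + t *s q) - c (s *s p) - c (t *s q)) holomorphic_on ball 0 \<rho>"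
      if "norm t < \<rho>" for t
      by (intro holomorphic_on_diff hol holomorphic_on_const)
        (use q small small' that in \<open>auto intro!: holomorphic_intros\<close>)
    show "(\<lambda>t. c (s *s p + t *s q) - c (s *s p) - c (t *s q)) holomorphic_on ball 0 \<rho>"
      if "norm s < \<rho>" for s
      by (intro holomorphic_on_diff hol holomorphic_on_const)
        (use q small small'' that in \<open>auto intro!: holomorphic_intros\<close>)
    show "norm (c (s *s p + t *s q) - c (s *s p) - c (t *s q)) \<le> 3 * M"
      if "norm s < \<rho>" "norm t < \<rho>" for s t
      using c_le[OF small[OF that q]] c_le[OF small'[OF that(1)]] c_le[OF small''[OF that(2) q]]
        norm_triangle_ineq4[of "c (s *s p + t *s q) - c (s *s p)" "c (t *s q)"]
        norm_triangle_ineq4[of "c (s *s p + t *s q)" "c (s *s p)"] by linarith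
  qed (use c0 st in auto)
  have pow_less: "norm (\<zeta> ^ k) < \<rho>" if "norm \<zeta> < R'" "k > 0" for \<zeta> :: complex and k
    using power_decreasing[of 1 k "norm \<zeta>"] that R' by (simp add: norm_power)
  have hol_h: "h holomorphic_on ball 0 R'"
    unfolding h_def by (rule hol) (use w R' in \<open>auto intro!: holomorphic_intros\<close>)
  have hol_A: "A holomorphic_on ball 0 R'"
    unfolding A_def by (rule hol) (use pow_less \<mu> small' in \<open>auto intro!: holomorphic_intros\<close>)
  \<comment> \<open>Mixed terms have order at least \<open>\<mu> 1 + \<mu> 2\<close>. Terms without
    the first variable have order at least \<open>2 * \<mu> 2\<close>, which is larger.\<close>
  have "norm (h \<zeta> - A \<zeta>) \<le> 4 * M / \<rho>\<^sup>2 * norm \<zeta> ^ (\<mu> 1 + \<mu> 2)" if \<zeta>: "norm \<zeta> < R'" for \<zeta>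
  proof -
    have s: "norm (\<zeta> ^ \<mu> 1) < \<rho>" and t: "norm (\<zeta> ^ \<mu> 2) < \<rho>" and v: "norm (v \<zeta>) \<le> norm w"
      using pow_less[OF \<zeta>] \<mu> v_le[of \<zeta>] \<zeta> R' by auto
    have "norm (h \<zeta> - A \<zeta>) \<le> norm (h \<zeta> - A \<zeta> - c (\<zeta> ^ \<mu> 2 *s v \<zeta>)) + norm (c (\<zeta> ^ \<mu> 2 *s v \<zeta>))"
      by norm
    also have "\<dots> \<le> 3 * M * norm (\<zeta> ^ \<mu> 1) * norm (\<zeta> ^ \<mu> 2) / \<rho>\<^sup>2 + M * (norm (\<zeta> ^ \<mu> 2) / \<rho>)\<^sup>2"
      unfolding h_def A_def split using bidisc[OF v s t] line[OF v t] by (rule add_mono)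
    also have "\<dots> = 3 * M / \<rho>\<^sup>2 * norm \<zeta> ^ (\<mu> 1 + \<mu> 2) + M / \<rho>\<^sup>2 * norm \<zeta> ^ (\<mu> 2 + \<mu> 2)"
      by (simp add: norm_power power_add power_divide power2_eq_square)
    also have "\<dots> \<le> 3 * M / \<rho>\<^sup>2 * norm \<zeta> ^ (\<mu> 1 + \<mu> 2) + M / \<rho>\<^sup>2 * norm \<zeta> ^ (\<mu> 1 + \<mu> 2)"
      using \<zeta> R' M \<mu> by (intro add_left_mono mult_left_mono power_decreasing) auto
    finally show ?thesis by (simp add: algebra_simps)
  qed
  moreover have "\<mu> i < \<mu> 1 + \<mu> 2" using \<mu> exhaust_3[of i] by auto
  ultimately have "(deriv ^^ \<mu> i) (\<lambda>\<zeta>. h \<zeta> - A \<zeta>) 0 = 0"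
    by (rule higher_deriv_eq_0_if_small[OF holomorphic_on_diff[OF hol_h hol_A] R'(1)])
  \<comment> \<open>\<open>A\<close> depends on \<open>\<zeta> ^ \<mu> 1\<close> only. Second-order
    vanishing of \<open>g\<close> excludes the exponent \<open>\<mu> 1\<close> itself; the exponents
    \<open>\<mu> 2\<close> and \<open>\<mu> 3\<close> are not multiples of
    \<open>\<mu> 1\<close>.\<close>
  moreover have "(deriv ^^ \<mu> i) A 0 = 0"
  proof (cases "i = 1")
    case True
    have "norm (A \<zeta>) \<le> M / \<rho>\<^sup>2 * norm \<zeta> ^ (2 * \<mu> 1)" if "norm \<zeta> < R'" for \<zeta>
      using line[OF p_le pow_less[OF that \<mu>(1)]]
      by (simp add: A_def power_divide norm_power mult.commute[of 2] flip: power_mult)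
    then have "(deriv ^^ \<mu> 1) A 0 = 0"
      by (rule higher_deriv_eq_0_if_small[OF hol_A R'(1)]) (use \<mu> in auto)
    then show ?thesis using True by simp
  next
    case False
    then have "\<not> \<mu> 1 dvd \<mu> i" using \<mu> exhaust_3[of i] by auto
    moreover have "A (cis (2 * pi / \<mu> 1) * \<zeta>) = A \<zeta>" for \<zeta>
    proof -
      have "cis (2 * pi / \<mu> 1) ^ \<mu> 1 = 1" using \<mu>(1) by (subst Complex.DeMoivre) simp
      then show ?thesis by (simp add: A_def power_mult_distrib)
    qed
    ultimately show ?thesis
      using higher_deriv_eq_0_if_root_invariant[OF hol_A R'(1) \<mu>(1)] by blast
  qed
  moreover have "(deriv ^^ \<mu> i) (\<lambda>\<zeta>. h \<zeta> - A \<zeta>) 0 = (deriv ^^ \<mu> i) h 0 - (deriv ^^ \<mu> i) A 0"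
    by (rule higher_deriv_diff[OF hol_h hol_A]) (use R' in auto)
  ultimately show ?thesis by (simp add: h_def[abs_def] c_def)
qed

section \<open>Automorphisms fixing the origin and their linearization defects\<close>

text \<open>The inverse is carried as an explicit second map, so that inverses and composites are
  again pairs. The two maps are constrained on \<open>D\<close> only.\<close>

definition origin_automorphism_pair :: "(complex ^ 'n) set \<Rightarrow> (complex ^ 'n \<Rightarrow> complex ^ 'n) \<Rightarrow> (complex ^ 'n \<Rightarrow> complex ^ 'n) \<Rightarrow> bool"
  where "origin_automorphism_pair D k l \<longleftrightarrow>
    holomorphic_map_on k D \<and> holomorphic_map_on l D \<and> k ` D \<subseteq> D \<and> l ` D \<subseteq> D \<and>
    (\<forall>z\<in>D. l (k z) = z) \<and> (\<forall>z\<in>D. k (l z) = z) \<and> k 0 = 0 \<and> l 0 = 0"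

lemma origin_automorphism_pair_sym:
  "origin_automorphism_pair D k l \<Longrightarrow> origin_automorphism_pair D l k"
  by (auto simp: origin_automorphism_pair_def)

lemma origin_automorphism_pair_compose:
  assumes "origin_automorphism_pair D k l" "origin_automorphism_pair D k' l'"
  shows "origin_automorphism_pair D (\<lambda>z. k' (k z)) (\<lambda>z. l (l' z))"
proof -
  have "holomorphic_map_on (\<lambda>z. k' (k z)) D"
    by (rule holomorphic_map_on_compose[of k D k' D]) (use assms in \<open>simp_all add: origin_automorphism_pair_def\<close>)
  moreover have "holomorphic_map_on (\<lambda>z. l (l' z)) D"
    by (rule holomorphic_map_on_compose[of l' D l D]) (use assms in \<open>simp_all add: origin_automorphism_pair_def\<close>)
  ultimately show ?thesis
    using assms by (simp add: origin_automorphism_pair_def image_subset_iff)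
qed

abbreviation derivative_at_0 :: "(complex ^ 'n \<Rightarrow> complex ^ 'n) \<Rightarrow> complex ^ 'n \<Rightarrow> complex ^ 'n"
  where "derivative_at_0 f \<equiv> frechet_derivative f (at 0)"

text \<open>The linearization defect \<open>k'(0)\<inverse> \<circ> k - id\<close>, with \<open>l\<close> in the role of the inverse of \<open>k\<close>.\<close>

definition linearization_defect :: "(complex ^ 'n \<Rightarrow> complex ^ 'n) \<Rightarrow> (complex ^ 'n \<Rightarrow> complex ^ 'n) \<Rightarrow> complex ^ 'n \<Rightarrow> complex ^ 'n"
  where "linearization_defect k l z = derivative_at_0 l (k z) - z"

lemma derivative_at_0_compose:
  assumes "holomorphic_map_on f D" "holomorphic_map_on g D" "f 0 = 0" "open D" "0 \<in> D"
  shows "derivative_at_0 (\<lambda>z. g (f z)) v = derivative_at_0 g (derivative_at_0 f v)"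
proof -
  have "((\<lambda>z. g (f z)) has_derivative (\<lambda>v. derivative_at_0 g (derivative_at_0 f v))) (at 0)"
    using has_derivative_compose[OF holomorphic_map_on_frechet_derivative(1)[OF assms(1,4,5)], of g]
      holomorphic_map_on_frechet_derivative(1)[OF assms(2,4,5)] assms(3) by simp
  then show ?thesis by (metis frechet_derivative_at)
qed

lemma derivative_at_0_complex_linear:
  assumes "Vector_Spaces.linear (*s) (*s) f"
  shows "derivative_at_0 f = f"
  using frechet_derivative_at[OF bounded_linear_imp_has_derivative[OF complex_linear_imp_bounded_linear[OF assms]]]
  by metis

text \<open>The chain rule for \<open>l\<close> after \<open>k\<close>, which is the identity on the
  neighbourhood \<open>D\<close> of 0. It justifies using \<open>derivative_at_0 l\<close> as the
  inverse of \<open>derivative_at_0 k\<close>.\<close>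

lemma derivative_at_0_pair:
  assumes pair: "origin_automorphism_pair D k l" and D: "open D" "0 \<in> D"
  shows "derivative_at_0 l (derivative_at_0 k v) = v"
proof -
  have "((\<lambda>z. l (k z)) has_derivative (\<lambda>v. v)) (at 0)"
    by (rule has_derivative_transform_within_open[OF has_derivative_ident D])
      (use pair in \<open>simp add: origin_automorphism_pair_def\<close>)
  then have "derivative_at_0 (\<lambda>z. l (k z)) = (\<lambda>v. v)" by (metis frechet_derivative_at)
  then show ?thesis
    using derivative_at_0_compose[of k D l v] pair D
    by (simp add: origin_automorphism_pair_def)
qed

context
  fixes D :: "(complex ^ 'n) set" and r B :: real
  assumes D: "open D" "0 \<in> D" and ball: "ball 0 r \<subseteq> D" and r: "r > 0"
    and B: "\<forall>z\<in>D. norm z \<le> B"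
begin

text \<open>Schwarz bounds whose constant involves the dimension, \<open>r\<close> and
  \<open>B\<close> but not the pair. This uniformity keeps the supremum over all automorphisms
  finite and allows one neighbourhood of 0 for all of them.\<close>

lemma origin_automorphism_pair_norm_le:
  assumes pair: "origin_automorphism_pair D k l"
  shows "norm z < r \<Longrightarrow> norm (k z) \<le> real CARD('n) * B / r * norm z"
    and "norm (derivative_at_0 k v) \<le> real CARD('n) * B / r * norm v"
proof -
  have hol: "holomorphic_map_on k D" and k0: "k 0 = 0" and sub: "k ` D \<subseteq> D"
    using pair by (auto simp: origin_automorphism_pair_def)
  have le: "norm (k z) \<le> B" if "norm z < r" for z
    using B sub ball that by (auto simp: subset_iff image_subset_iff)
  show *: "norm (k z) \<le> real CARD('n) * B / r * norm z" if "norm z < r" for z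
    using holomorphic_map_Schwarz_bound[OF holomorphic_map_on_subset[OF hol ball] k0 le that] .
  show "norm (derivative_at_0 k v) \<le> real CARD('n) * B / r * norm v"
    by (rule norm_derivative_le[OF _ _ k0 r *]) (use holomorphic_map_on_frechet_derivative[OF hol D] in auto)
qed

lemma norm_linearization_defect_le:
  assumes pair: "origin_automorphism_pair D k l" and z: "z \<in> D"
  shows "norm (linearization_defect k l z) \<le> real CARD('n) * B / r * B + B"
proof -
  have "k z \<in> D" using pair z by (auto simp: origin_automorphism_pair_def)
  have "norm (linearization_defect k l z) \<le> norm (derivative_at_0 l (k z)) + norm z"
    unfolding linearization_defect_def by (rule norm_triangle_ineq4)
  also have "\<dots> \<le> real CARD('n) * B / r * norm (k z) + B"
    by (intro add_mono bspec[OF B] z origin_automorphism_pair_norm_le(2)[OF origin_automorphism_pair_sym[OF pair]])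
  also have "\<dots> \<le> real CARD('n) * B / r * B + B"
    using bspec[OF B \<open>k z \<in> D\<close>] bspec[OF B D(2)] r by (intro add_right_mono mult_left_mono) auto
  finally show ?thesis .
qed

lemma holomorphic_map_on_linearization_defect:
  assumes "origin_automorphism_pair D k l"
  shows "holomorphic_map_on (linearization_defect k l) D"
    and "linearization_defect k l 0 = 0"
    and "(linearization_defect k l has_derivative (\<lambda>_. 0)) (at 0)"
proof -
  have hol: "holomorphic_map_on k D" "holomorphic_map_on l D" and 0: "k 0 = 0"
    using assms by (auto simp: origin_automorphism_pair_def)
  note k' = holomorphic_map_on_frechet_derivative[OF hol(1) D]
  note l' = holomorphic_map_on_frechet_derivative[OF hol(2) D]
  show "holomorphic_map_on (linearization_defect k l) D"
    unfolding linearization_defect_def[abs_def]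
    by (intro holomorphic_map_on_diff
        holomorphic_map_on_compose[OF hol(1) complex_linear_imp_holomorphic_map_on[OF l'(2), of UNIV]]
        complex_linear_imp_holomorphic_map_on[OF vec.linear_id[unfolded id_def]] subset_UNIV)
  show "linearization_defect k l 0 = 0"
    using linear_0[OF bounded_linear.linear[OF complex_linear_imp_bounded_linear[OF l'(2)]]]
    by (simp add: linearization_defect_def 0)
  have "((\<lambda>z. derivative_at_0 l (k z) - z) has_derivative
      (\<lambda>v. derivative_at_0 l (derivative_at_0 k v) - v)) (at 0)"
    by (intro has_derivative_diff has_derivative_ident
        bounded_linear.has_derivative[OF complex_linear_imp_bounded_linear[OF l'(2)]] k'(1))
  then show "(linearization_defect k l has_derivative (\<lambda>_. 0)) (at 0)"
    unfolding linearization_defect_def[abs_def] by (simp add: derivative_at_0_pair[OF assms D])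
qed

text \<open>For \<open>T = id\<close> the left-hand side is 0, so the second summand is then minus the first.\<close>

lemma linearization_defect_conjugate:
  assumes pair: "origin_automorphism_pair D k l" and T: "origin_automorphism_pair D T T'"
    and lin: "Vector_Spaces.linear (*s) (*s) T" "Vector_Spaces.linear (*s) (*s) T'" and z: "z \<in> D"
  shows "linearization_defect (\<lambda>z. l (T (k z))) (\<lambda>z. l (T' (k z))) z
    = linearization_defect k l z
      + derivative_at_0 l (T' (linearization_defect l k (T (k z))))"
proof -
  have hol: "holomorphic_map_on k D" "holomorphic_map_on l D" "holomorphic_map_on T' D"
    and 0: "k 0 = 0" "T' 0 = 0" and "k ` D \<subseteq> D" "T' ` D \<subseteq> D" "T' (T (k z)) = k z"
    using pair T z by (auto simp: origin_automorphism_pair_def)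
  note l' = complex_linear_imp_bounded_linear[OF holomorphic_map_on_frechet_derivative(2)[OF hol(2) D]]
  note T' = complex_linear_imp_bounded_linear[OF lin(2)]
  have "holomorphic_map_on (\<lambda>z. T' (k z)) D"
    by (rule holomorphic_map_on_compose[OF hol(1,3) \<open>k ` D \<subseteq> D\<close>])
  then have "derivative_at_0 (\<lambda>z. l (T' (k z))) v = derivative_at_0 l (T' (derivative_at_0 k v))" for v
    using derivative_at_0_compose[of "\<lambda>z. T' (k z)" D l] derivative_at_0_compose[of k D T'] hol 0 D
    by (simp add: derivative_at_0_complex_linear[OF lin(2)])
  \<comment> \<open>After expanding both defects on the right, the two occurrences of
    \<open>derivative_at_0 l (k z)\<close> cancel.\<close>
  then show ?thesis
    using \<open>T' (T (k z)) = k z\<close>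
    by (simp add: linearization_defect_def linear_diff[OF bounded_linear.linear[OF l']] linear_diff[OF bounded_linear.linear[OF T']])
qed

end

section \<open>Vanishing of the defect near the origin\<close>

text \<open>The averaging lemma is applied, at a fixed \<open>z\<close>, to the set of defect values
  of all pairs. Conjugating a rotation by one pair produces other pairs, so \<open>\<delta>\<close>
  must not depend on the pair.\<close>

theorem linearization_defect_eq_0:
  fixes D :: "(complex ^ 3) set" and \<mu> :: "3 \<Rightarrow> nat"
  assumes D: "open D" "0 \<in> D" "bounded D"
    and rot: "\<And>\<theta>. weighted_action \<mu> (cis \<theta>) ` D \<subseteq> D"
    and \<mu>: "0 < \<mu> 1" "\<mu> 1 < \<mu> 2" "\<mu> 2 < \<mu> 3" "\<mu> 3 < \<mu> 1 + \<mu> 2" "\<not> \<mu> 1 dvd \<mu> 2" "\<not> \<mu> 1 dvd \<mu> 3"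
  shows "\<exists>\<delta>>0. ball 0 \<delta> \<subseteq> D \<and>
    (\<forall>k l z. origin_automorphism_pair D k l \<longrightarrow> norm z < \<delta> \<longrightarrow> linearization_defect k l z = 0)"
proof -
  obtain r where r: "r > 0" and ball: "ball 0 r \<subseteq> D" using D open_contains_ball by blast
  obtain B where B0: "B > 0" and B: "\<forall>z\<in>D. norm z \<le> B"
    using D(3) bounded_pos by blast
  define C where "C = real CARD(3) * B / r"
  define M where "M = C * B + B"
  \<comment> \<open>\<open>Q\<close> bounds the factors \<open>\<zeta> ^ \<mu> i\<close> on the disc
    of radius 3 that the root-of-unity estimate requires, and \<open>C\<close> bounds the growth of
    \<open>k\<close>. The choice of \<open>\<delta>\<close> thus keeps the orbit of
    \<open>k z\<close> over that disc inside the ball of radius \<open>r\<close>.\<close>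
  define Q :: real where "Q = 3 ^ \<mu> 3"
  define \<delta> where "\<delta> = r / (Q * (C + 1))"
  have C: "C > 0" using r B0 by (simp add: C_def)
  have Q: "Q \<ge> 1" by (simp add: Q_def)
  have "1 * 1 \<le> Q * (C + 1)" using Q C by (intro mult_mono) auto
  then have \<delta>: "\<delta> > 0" "\<delta> \<le> r" using r by (auto simp: \<delta>_def divide_le_eq mult_le_cancel_left1)
  note pair_le = origin_automorphism_pair_norm_le[OF D(1,2) ball r B, folded C_def]
  note defect_le = norm_linearization_defect_le[OF D(1,2) ball r B, folded C_def, folded M_def]
  note defect_hol = holomorphic_map_on_linearization_defect[OF D(1,2) ball r B]
  have M: "M \<ge> 0" using C B0 by (simp add: M_def)
  have rot_pair: "origin_automorphism_pair D (weighted_action \<mu> (cis \<theta>)) (weighted_action \<mu> (cis (- \<theta>)))" for \<theta>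
    unfolding origin_automorphism_pair_def using rot
    by (auto simp: weighted_action_mult cis_mult complex_linear_imp_holomorphic_map_on
        complex_linear_weighted_action vec_eq_iff)
  have "{d. \<exists>k l. origin_automorphism_pair D k l \<and> d = linearization_defect k l z} \<subseteq> {0}" (is "?A \<subseteq> _")
    if z: "norm z < \<delta>" for z
  proof (rule subset_zero_if_averaging)
    have zD: "z \<in> D" using z \<delta> ball by auto
    show "bounded ?A" using defect_le[OF _ zD] by (auto intro!: boundedI)
    show "(\<lambda>N. C * (3 * (2 * M * real N / 2 ^ N))) \<longlonglongrightarrow> 0" by real_asymp
    \<comment> \<open>The threshold makes \<open>N\<close> exceed every weight, so that the
      coefficient of index \<open>\<mu> i\<close> lies among those filtered.\<close>
    fix N d assume N: "Suc (\<mu> 3) \<le> N" and "d \<in> ?A"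
    then obtain k l where pair: "origin_automorphism_pair D k l" and d: "d = linearization_defect k l z"
      by blast
    note pair' = origin_automorphism_pair_sym[OF pair]
    define w where "w = k z"
    define c where "c = linearization_defect l k"
    define W where "W \<theta> = weighted_action \<mu> (cis \<theta>)" for \<theta>
    define \<theta> where "\<theta> j = 2 * pi * real j / real N" for j
    define X where "X j = derivative_at_0 l (W (- \<theta> j) (c (W (\<theta> j) w)))" for j
    have l': "linear (derivative_at_0 l)"
      using pair D holomorphic_map_on_frechet_derivative(2)[of l D 0] complex_linear_imp_bounded_linear
      by (auto simp: origin_automorphism_pair_def intro: bounded_linear.linear)
    have action_w: "norm (weighted_action \<mu> \<zeta> w) < r" if \<zeta>: "norm \<zeta> < 3" for \<zeta>
    proof -
      have pow: "norm \<zeta> ^ \<mu> i \<le> Q" for i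
      proof -
        have "norm \<zeta> ^ \<mu> i \<le> 3 ^ \<mu> i" using \<zeta> by (intro power_mono) auto
        also have "\<dots> \<le> Q" unfolding Q_def using \<mu> exhaust_3[of i] by (intro power_increasing) auto
        finally show ?thesis .
      qed
      have "norm (weighted_action \<mu> \<zeta> w) \<le> norm (of_real Q *s w)"
        using pow Q by (intro norm_le_componentwise_cart) (auto simp: norm_mult norm_power intro: mult_right_mono)
      also have "\<dots> = Q * norm w" using Q by (simp add: norm_vector_scalar_mult)
      also have "\<dots> \<le> Q * (C * norm z)"
        using pair_le(1)[OF pair, of z] z \<delta> Q by (simp add: w_def)
      also have "\<dots> \<le> Q * (C + 1) * norm z" using Q by (simp add: algebra_simps)
      also have "\<dots> < Q * (C + 1) * \<delta>" using z Q C by (intro mult_strict_left_mono) auto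
      also have "\<dots> = r" using Q C by (simp add: \<delta>_def)
      finally show ?thesis .
    qed
    have "norm (\<Sum>j<N. X j) \<le> C * (3 * (2 * M * real N / 2 ^ N))"
    proof -
      define s where "s = (\<Sum>j<N. W (- \<theta> j) (c (W (\<theta> j) w)))"
      have "norm (s $ i) \<le> 2 * M * real N / 2 ^ N" for i
      proof -
        define h where "h \<zeta> = c (weighted_action \<mu> \<zeta> w) $ i" for \<zeta>
        have c_le: "norm (c y) \<le> M" if "norm y < r" for y
          unfolding c_def using that ball by (intro defect_le[OF pair']) auto
        have c_hol: "holomorphic_map_on c (ball 0 r)"
          unfolding c_def using defect_hol(1)[OF pair'] ball by (auto intro: holomorphic_map_on_subset)
        \<comment> \<open>Undoing the rotation multiplies component \<open>i\<close> by the factor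
          that selects the coefficient of index \<open>\<mu> i\<close>, which is zero by
          nonresonance.\<close>
        have "s $ i = (\<Sum>j<N. cis (- (2 * pi * real j / N) * \<mu> i) * h (cis (2 * pi * real j / N)))"
          unfolding s_def sum_component
        proof (intro sum.cong refl)
          fix j
          have "cis (- \<theta> j) ^ \<mu> i = cis (- (2 * pi * real j / N) * \<mu> i)"
            by (simp only: Complex.DeMoivre \<theta>_def mult.commute)
          then show "W (- \<theta> j) (c (W (\<theta> j) w)) $ i = cis (- (2 * pi * real j / N) * \<mu> i) * h (cis (2 * pi * real j / N))"
            by (simp only: W_def h_def weighted_action_nth \<theta>_def)
        qed
        moreover have "norm (\<Sum>j<N. cis (- (2 * pi * real j / N) * \<mu> i) * h (cis (2 * pi * real j / N)))
            \<le> 2 * M * real N / 2 ^ N"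
        proof (rule root_of_unity_average_bound)
          show "h holomorphic_on ball 0 3"
            unfolding h_def by (rule holomorphic_on_component_compose[OF c_hol])
              (use action_w in \<open>auto intro!: holomorphic_intros\<close>)
          show "norm (h \<zeta>) \<le> M" if "norm \<zeta> < 3" for \<zeta>
            unfolding h_def
            using order_trans[OF Finite_Cartesian_Product.norm_nth_le c_le[OF action_w[OF that]]] .
          show "(deriv ^^ \<mu> i) h 0 = 0"
            unfolding h_def
            by (rule nonresonant_higher_deriv_eq_0[OF c_hol _ _ c_le \<mu> _ action_w])
              (use defect_hol(2,3)[OF pair'] in \<open>auto simp: c_def\<close>)
          show "\<mu> i < N" using N \<mu> exhaust_3[of i] by auto
        qed
        ultimately show ?thesis by simp
      qed
      then have "(\<Sum>i\<in>UNIV. norm (s $ i)) \<le> 3 * (2 * M * real N / 2 ^ N)"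
        using sum_bounded_above[of "UNIV :: 3 set" "\<lambda>i. norm (s $ i)" "2 * M * real N / 2 ^ N"] by simp
      then have "norm s \<le> 3 * (2 * M * real N / 2 ^ N)"
        unfolding norm_vec_def by (rule order_trans[OF L2_set_le_sum, rotated]) simp
      then have "C * norm s \<le> C * (3 * (2 * M * real N / 2 ^ N))"
        using C by (intro mult_left_mono) auto
      moreover have "(\<Sum>j<N. X j) = derivative_at_0 l s"
        by (simp add: X_def s_def linear_sum[OF l'])
      ultimately show ?thesis
        using pair_le(2)[OF pair', of s] by (metis order_trans)
    qed
    \<comment> \<open>Both rotations are the identity for \<open>j = 0\<close>, and
      \<open>c w\<close> is \<open>derivative_at_0 k z - k z\<close>; applying
      \<open>derivative_at_0 l\<close> turns this into
      \<open>z - derivative_at_0 l (k z)\<close>.\<close>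
    moreover have "X 0 = - d"
    proof -
      have "l w = z" using pair zD by (simp add: w_def origin_automorphism_pair_def)
      then show ?thesis
        by (simp add: X_def W_def \<theta>_def c_def d linearization_defect_def linear_diff[OF l'] w_def
            derivative_at_0_pair[OF pair D(1,2)])
    qed
    moreover have "d + X j \<in> ?A" for j
    proof -
      have "origin_automorphism_pair D (\<lambda>z. l (W (\<theta> j) (k z))) (\<lambda>z. l (W (- \<theta> j) (k z)))"
        unfolding W_def
        using origin_automorphism_pair_compose[OF origin_automorphism_pair_compose[OF pair rot_pair] pair'] .
      moreover have "linearization_defect (\<lambda>z. l (W (\<theta> j) (k z))) (\<lambda>z. l (W (- \<theta> j) (k z))) z = d + X j"
        unfolding d X_def c_def w_def W_def
        by (rule linearization_defect_conjugate[OF D(1,2) ball r B pair rot_pair _ _ zD])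
          (auto simp: complex_linear_weighted_action)
      ultimately show ?thesis by (metis (mono_tags, lifting) mem_Collect_eq)
    qed
    ultimately show "\<exists>X. (\<forall>j<N. d + X j \<in> ?A) \<and> X 0 = - d \<and>
        norm (\<Sum>j<N. X j) \<le> C * (3 * (2 * M * real N / 2 ^ N))"
      by blast
  qed
  moreover have "ball 0 \<delta> \<subseteq> D" using \<delta>(2) ball by auto
  ultimately show ?thesis using \<delta>(1) by blast
qed

section \<open>From the neighbourhood of the origin to the whole domain\<close>

theorem corollary3p2:
  fixes D :: "(complex ^ 3) set" and m1 m2 m3 :: nat and f :: "complex ^ 3 \<Rightarrow> complex ^ 3"
  assumes "quasi_circular_domain m1 m2 m3 D"
    and "bounded D"
    and "0 \<in> D"
    and "m1 < m2" and "m2 < m3"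
    and "3 \<le> m1"
    and "\<not> [m2 = 0] (mod m1)" and "\<not> [m3 = 0] (mod m1)"
    and "m1 + m2 > m3"
    and "holomorphic_automorphism f D"
    and "f 0 = 0"
  shows "\<exists>L :: complex ^ 3 \<Rightarrow> complex ^ 3.
           Vector_Spaces.linear (*s) (*s) L \<and> (\<forall>z\<in>D. f z = L z)"
proof -
  define \<mu> :: "3 \<Rightarrow> nat" where "\<mu> i = (if i = 1 then m1 else if i = 2 then m2 else m3)" for i
  have \<mu>_simps: "\<mu> 1 = m1" "\<mu> 2 = m2" "\<mu> 3 = m3" by (simp_all add: \<mu>_def)
  have D: "open D" "connected D" and rot: "weighted_rotation m1 m2 m3 \<theta> ` D = D" for \<theta>
    using assms(1) by (auto simp: quasi_circular_domain_def is_domain_def)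
  have rotation: "weighted_rotation m1 m2 m3 \<theta> = weighted_action \<mu> (cis \<theta>)" for \<theta>
  proof
    fix z
    have "exp (\<i> * of_nat m * of_real \<theta>) = cis \<theta> ^ m" for m
      by (simp add: cis_conv_exp mult_ac flip: exp_of_nat_mult)
    then show "weighted_rotation m1 m2 m3 \<theta> z = weighted_action \<mu> (cis \<theta>) z"
      by (simp add: weighted_rotation_def vec_eq_iff forall_3 \<mu>_simps)
  qed
  define l where "l = inv_into D f"
  have bij: "bij_betw f D D" and hol: "holomorphic_map_on f D" "holomorphic_map_on l D"
    using assms(10) by (auto simp: holomorphic_automorphism_def biholomorphic_map_def l_def)
  have pair: "origin_automorphism_pair D f l"
    unfolding origin_automorphism_pair_def
  proof (intro conjI ballI hol)
    show "l 0 = 0" unfolding l_def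
      using inv_into_f_f[OF bij_betw_imp_inj_on[OF bij] assms(3)] assms(11) by simp
  qed (use bij assms(11) in \<open>auto simp: l_def bij_betw_def inv_into_into f_inv_into_f\<close>)
  have "weighted_action \<mu> (cis \<theta>) ` D \<subseteq> D" for \<theta>
    using rot[of \<theta>] unfolding rotation by simp
  moreover have "0 < \<mu> 1" "\<mu> 1 < \<mu> 2" "\<mu> 2 < \<mu> 3" "\<mu> 3 < \<mu> 1 + \<mu> 2" "\<not> \<mu> 1 dvd \<mu> 2" "\<not> \<mu> 1 dvd \<mu> 3"
    using assms(4-9) by (simp_all add: \<mu>_simps cong_0_iff)
  ultimately obtain \<delta> where \<delta>: "\<delta> > 0" "ball 0 \<delta> \<subseteq> D"
      "\<And>k l z. origin_automorphism_pair D k l \<Longrightarrow> norm z < \<delta> \<Longrightarrow> linearization_defect k l z = 0"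
    using linearization_defect_eq_0[OF D(1) assms(3,2), of \<mu>] by blast
  note f' = holomorphic_map_on_frechet_derivative(2)[OF hol(1) D(1) assms(3)]
  \<comment> \<open>Near 0 the vanishing defect says that \<open>derivative_at_0 l\<close> inverts
    \<open>f\<close>; applying \<open>derivative_at_0 f\<close> gives linearity there, and the
    identity theorem extends it to the connected set \<open>D\<close>.\<close>
  have "f z = derivative_at_0 f z" if "z \<in> D" for z
  proof (rule holomorphic_map_identity[OF hol(1) complex_linear_imp_holomorphic_map_on[OF f'] D _ _ \<delta>(2)])
    fix y :: "complex ^ 3" assume "y \<in> ball 0 \<delta>"
    then have "derivative_at_0 l (f y) = y"
      using \<delta>(3)[OF pair, of y] by (simp add: linearization_defect_def)
    then show "f y = derivative_at_0 f y"
      using derivative_at_0_pair[OF origin_automorphism_pair_sym[OF pair] D(1) assms(3), of "f y"] by simp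
  qed (use that \<delta>(1) in auto)
  then show ?thesis by (intro exI[of _ "derivative_at_0 f"] conjI f') simp
qed

end
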